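(* Let $(\mathcal{E},\cdot)$ be a Leibniz algebra, and for $s\neq 0$, let $\diamond_s:\mathcal{E}\times\mathcal{E}\to\mathcal{E}$ be defined by $$x\diamond_s y=x+\exp(s\lambda(x))y$$ for $x,y\in\mathcal{E}$. Then $(\mathcal{E},\diamond_s)$ is a homogeneous left loop for which the binary bracket in the associated Lie-Yamaguti algebra is $2s$ times the skew-symmetrized Leibniz product $[\![x,y]\!]=\tfrac12(x\cdot y-y\cdot x)$. In particular, the skew-symmetrized Leibniz product itself is recovered when $s=1/2$.
   Context: A (left) Leibniz algebra is a vector space $\mathcal{E}$ (not assumed finite-dimensional) with a bilinear operation satisfying $x\cdot(y\cdot z)=(x\cdot y)\cdot z+y\cdot(x\cdot z)$ for all $x,y,z$. $\lambda(x):\mathcal{E}\to\mathcal{E}$ is left multiplication, $\lambda(x)y=x\cdot y$, which is a derivation of $(\mathcal{E},\cdot)$; $s$ is a nonzero scalar. Enveloping Lie algebra: let $\mathfrak{h}$ be a Lie algebra with a derivation action on $\mathcal{E}$, i.e. a Lie algebra homomorphism $\mathfrak{h}\to\mathrm{Der}(\mathcal{E})$ (derivations of $(\mathcal{E},\cdot)$), written $(\xi,x)\mapsto\xi x$, and let $f:\mathcal{E}\to\mathfrak{h}$ be a linear map such that $[\xi,f(x)]=f(\xi x)$ and $f(x)y=x\cdot y$ for all $\xi\in\mathfrak{h}$, $x,y\in\mathcal{E}$. Let $\mathfrak{g}=\mathfrak{h}\ltimes\mathcal{E}$ be the semidirect product Lie algebra, with $\mathcal{E}$ regarded as abelian: $[(\xi,x),(\eta,y)]=([\xi,\eta],\xi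 y-\eta x)$. Then $(\mathfrak{g},\mathfrak{h},f)$ is an enveloping Lie algebra of $(\mathcal{E},\cdot)$. (For example $\mathfrak{h}=\mathrm{Der}(\mathcal{E})$, $f=\lambda$.) Setting, and meaning of $\exp$: $(\mathfrak{g},\mathfrak{h},f)$ is an enveloping Lie algebra of $(\mathcal{E},\cdot)$, and $H$ is a Lie group with Lie algebra $\mathfrak{h}$ such that the derivation action of $\mathfrak{h}$ on $\mathcal{E}$ lifts to an action of $H$ on $\mathcal{E}$ by automorphisms of $(\mathcal{E},\cdot)$. The exponential $\exp(s\lambda(x))$ of the derivation $s\lambda(x)$ is then the automorphism by which $\exp(sf(x))\in H$ acts on $\mathcal{E}$. Left loops: a left loop is a set $X$ with a binary operation $\diamond$ and an element $e\in X$ such that for all $a,b\in X$ the equation $a\diamond x=b$ has a unique solution $x\in X$, and $e\diamond a=a\diamond e=a$ for all $a$. (Here $e=0\in\mathcal{E}$.) The left inner mappings $L(a,b):X\to X$ are the permutations defined by $a\diamond(b\diamond c)=(a\diamond b)\diamond L(a,b)(c)$. The left loop has the left inverse property if for each $a\in X$ there is $a'\in X$ with $a'\diamond(a\diamond b)=a\diamond(a'\diamond b)=b$ for all $b\in X$; it has the $A_l$ property if every left inner mapping $L(a,b)$ is an automorphism of $(X,\diamond)$. It is homogeneous if it has both the left inverse property and the $A_l$ property. Associated Lie-Yamaguti algebra: for $s\neq0$ put $\sigma_s(x)=(sf(x),x)$ and $\mathcal{E}_s=\sigma_s(\mathcal{E})\subseteq\mathfrak{g}$. Then $\mathfrak{g}=\mathfrak{h}\oplus\mathcal{E}_s$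 is a reductive decomposition ($[\mathfrak{h},\mathfrak{h}]\subseteq\mathfrak{h}$, $[\mathfrak{h},\mathcal{E}_s]\subseteq\mathcal{E}_s$). The Lie-Yamaguti algebra associated with $(\mathcal{E},\diamond_s)$ is the one induced by this decomposition on $\mathcal{E}_s$, identified with $\mathcal{E}$ via $\sigma_s$: for $x,y,z\in\mathcal{E}_s$ its binary bracket is the $\mathcal{E}_s$-component of $[x,y]$, and its ternary product is $[[x,y]_{\mathfrak{h}},z]$, where $[x,y]_{\mathfrak{h}}$ is the $\mathfrak{h}$-component of $[x,y]$, components being taken in $\mathfrak{h}\oplus\mathcal{E}_s$. *)

theory Defs
  imports "HOL-Analysis.Analysis" "HOL-Algebra.Group_Action"
begin

section \<open>Leibniz algebras and enveloping Lie algebras\<close>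

definition leibniz_algebra :: "('e::real_vector \<Rightarrow> 'e \<Rightarrow> 'e) \<Rightarrow> bool" where
  "leibniz_algebra mul \<longleftrightarrow> bilinear mul \<and>
     (\<forall>x y z. mul x (mul y z) = mul (mul x y) z + mul y (mul x z))"

definition lie_algebra :: "('h::real_vector \<Rightarrow> 'h \<Rightarrow> 'h) \<Rightarrow> bool" where
  "lie_algebra br \<longleftrightarrow> bilinear br \<and> (\<forall>x. br x x = 0) \<and>
     (\<forall>x y z. br x (br y z) + br y (br z x) + br z (br x y) = 0)"

definition is_derivation :: "('e::real_vector \<Rightarrow> 'e \<Rightarrow> 'e) \<Rightarrow> ('e \<Rightarrow> 'e) \<Rightarrow> bool" where
  "is_derivation mul D \<longleftrightarrow> linear D \<and> (\<forall>x y. D (mul x y) = mul (D x) y + mul x (D y))"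

definition is_automorphism :: "('e::real_vector \<Rightarrow> 'e \<Rightarrow> 'e) \<Rightarrow> ('e \<Rightarrow> 'e) \<Rightarrow> bool" where
  "is_automorphism mul F \<longleftrightarrow> linear F \<and> bij F \<and> (\<forall>x y. F (mul x y) = mul (F x) (F y))"

definition derivation_action ::
  "('e::real_vector \<Rightarrow> 'e \<Rightarrow> 'e) \<Rightarrow> ('h::real_vector \<Rightarrow> 'h \<Rightarrow> 'h) \<Rightarrow> ('h \<Rightarrow> 'e \<Rightarrow> 'e) \<Rightarrow> bool" where
  "derivation_action mul br \<rho> \<longleftrightarrow>
     (\<forall>\<xi>. is_derivation mul (\<rho> \<xi>)) \<and> (\<forall>x. linear (\<lambda>\<xi>. \<rho> \<xi> x)) \<and>
     (\<forall>\<xi> \<eta> x. \<rho> (br \<xi> \<eta>) x = \<rho> \<xi> (\<rho> \<eta> x) - \<rho> \<eta> (\<rho> \<xi> x))"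

text \<open>The enveloping Lie algebra is the semidirect product below, on the type \<open>'h \<times> 'e\<close>;
  it is determined by the data \<open>br\<close>, \<open>\<rho>\<close>, \<open>f\<close>.\<close>

definition enveloping_lie_algebra ::
  "('e::real_vector \<Rightarrow> 'e \<Rightarrow> 'e) \<Rightarrow> ('h::real_vector \<Rightarrow> 'h \<Rightarrow> 'h) \<Rightarrow> ('h \<Rightarrow> 'e \<Rightarrow> 'e) \<Rightarrow> ('e \<Rightarrow> 'h) \<Rightarrow> bool" where
  "enveloping_lie_algebra mul br \<rho> f \<longleftrightarrow>
     lie_algebra br \<and> derivation_action mul br \<rho> \<and> linear f \<and>
     (\<forall>\<xi> x. br \<xi> (f x) = f (\<rho> \<xi> x)) \<and> (\<forall>x y. \<rho> (f x) y = mul x y)"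

definition semidirect_bracket ::
  "('h::real_vector \<Rightarrow> 'h \<Rightarrow> 'h) \<Rightarrow> ('h \<Rightarrow> 'e::real_vector \<Rightarrow> 'e) \<Rightarrow> 'h \<times> 'e \<Rightarrow> 'h \<times> 'e \<Rightarrow> 'h \<times> 'e" where
  "semidirect_bracket br \<rho> u v =
     (br (fst u) (fst v), \<rho> (fst u) (snd v) - \<rho> (fst v) (snd u))"

definition skew_product :: "('e::real_vector \<Rightarrow> 'e \<Rightarrow> 'e) \<Rightarrow> 'e \<Rightarrow> 'e \<Rightarrow> 'e" where
  "skew_product mul x y = (1/2) *\<^sub>R (mul x y - mul y x)"


section \<open>Lie groups\<close>

text \<open>Classes \<open>C\<^sup>k\<close> on an open set. Asking that each directional derivative be \<open>C\<^sup>k\<close> (rather than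
  the derivative as an operator-valued map) keeps the recursion within one type; on open subsets
  of Banach spaces the resulting notion of smoothness (\<open>C\<^sup>k\<close> for all \<open>k\<close>) is the usual Frechet
  one, by the uniform boundedness principle.\<close>

primrec Ck_on :: "nat \<Rightarrow> 'a::real_normed_vector set \<Rightarrow> ('a \<Rightarrow> 'b::real_normed_vector) \<Rightarrow> bool" where
  "Ck_on 0 S F \<longleftrightarrow> continuous_on S F"
| "Ck_on (Suc k) S F \<longleftrightarrow> (\<forall>x\<in>S. F differentiable (at x)) \<and>
     (\<forall>v. Ck_on k S (\<lambda>x. frechet_derivative F (at x) v))"

definition smooth_on :: "'a::real_normed_vector set \<Rightarrow> ('a \<Rightarrow> 'b::real_normed_vector) \<Rightarrow> bool" where
  "smooth_on S F \<longleftrightarrow> (\<forall>k. Ck_on k S F)"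

text \<open>Charts are pairs \<open>(U, \<phi>)\<close> of a domain and a coordinate map; values of \<open>\<phi>\<close> outside \<open>U\<close> are
  irrelevant. The model space is a Banach space, so finite-dimensional Lie groups are included
  but not the only ones.\<close>

definition smooth_atlas :: "'g topology \<Rightarrow> ('g set \<times> ('g \<Rightarrow> 'h::banach)) set \<Rightarrow> bool" where
  "smooth_atlas T \<A> \<longleftrightarrow>
     (\<forall>(U, \<phi>)\<in>\<A>. openin T U \<and> open (\<phi> ` U) \<and>
        homeomorphic_map (subtopology T U) (top_of_set (\<phi> ` U)) \<phi>) \<and>
     (\<Union>(U, \<phi>)\<in>\<A>. U) = topspace T \<and>
     (\<forall>(U, \<phi>)\<in>\<A>. \<forall>(V, \<psi>)\<in>\<A>. smooth_on (\<phi> ` (U \<inter> V)) (\<lambda>x. \<psi> (inv_into U \<phi> x)))"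

definition lie_group ::
  "('g, 'm) monoid_scheme \<Rightarrow> 'g topology \<Rightarrow> ('g set \<times> ('g \<Rightarrow> 'h::banach)) set \<Rightarrow> bool" where
  "lie_group H T \<A> \<longleftrightarrow>
     group H \<and> topspace T = carrier H \<and> Hausdorff_space T \<and> smooth_atlas T \<A> \<and>
     continuous_map (prod_topology T T) T (\<lambda>(a, b). a \<otimes>\<^bsub>H\<^esub> b) \<and>
     (\<forall>(U, \<phi>)\<in>\<A>. \<forall>(V, \<psi>)\<in>\<A>. \<forall>(W, \<theta>)\<in>\<A>.
        smooth_on {(\<phi> a, \<psi> b) | a b. a \<in> U \<and> b \<in> V \<and> a \<otimes>\<^bsub>H\<^esub> b \<in> W}
          (\<lambda>(x, y). \<theta> (inv_into U \<phi> x \<otimes>\<^bsub>H\<^esub> inv_into V \<psi> y))) \<and>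
     continuous_map T T (\<lambda>a. inv\<^bsub>H\<^esub> a) \<and>
     (\<forall>(U, \<phi>)\<in>\<A>. \<forall>(V, \<psi>)\<in>\<A>.
        smooth_on {\<phi> a | a. a \<in> U \<and> inv\<^bsub>H\<^esub> a \<in> V} (\<lambda>x. \<psi> (inv\<^bsub>H\<^esub> (inv_into U \<phi> x))))"

text \<open>The tangent space at the identity is identified with the model space \<open>'h\<close> by the
  differential of a chart \<open>(U, \<kappa>)\<close> centred at the identity. In this chart,
  \<open>left_invariant_field H U \<kappa> \<xi>\<close> is the left-invariant vector field with value \<open>\<xi>\<close> at the
  identity, and the bracket of the Lie algebra of \<open>H\<close> is the bracket
  \<open>[X, Y] = DY X - DX Y\<close> of these fields, evaluated at the identity.\<close>

definition left_invariant_field ::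
  "('g, 'm) monoid_scheme \<Rightarrow> 'g set \<Rightarrow> ('g \<Rightarrow> 'h::real_normed_vector) \<Rightarrow> 'h \<Rightarrow> 'h \<Rightarrow> 'h" where
  "left_invariant_field H U \<kappa> \<xi> x =
     frechet_derivative (\<lambda>y. \<kappa> (inv_into U \<kappa> x \<otimes>\<^bsub>H\<^esub> inv_into U \<kappa> y)) (at 0) \<xi>"

definition is_lie_algebra_of ::
  "('h::banach \<Rightarrow> 'h \<Rightarrow> 'h) \<Rightarrow> ('g, 'm) monoid_scheme \<Rightarrow> ('g set \<times> ('g \<Rightarrow> 'h)) set \<Rightarrow>
     'g set \<Rightarrow> ('g \<Rightarrow> 'h) \<Rightarrow> bool" where
  "is_lie_algebra_of br H \<A> U \<kappa> \<longleftrightarrow>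
     (U, \<kappa>) \<in> \<A> \<and> \<one>\<^bsub>H\<^esub> \<in> U \<and> \<kappa> \<one>\<^bsub>H\<^esub> = 0 \<and>
     (\<forall>\<xi> \<eta>. br \<xi> \<eta> =
        frechet_derivative (left_invariant_field H U \<kappa> \<eta>) (at 0) \<xi> -
        frechet_derivative (left_invariant_field H U \<kappa> \<xi>) (at 0) \<eta>)"

text \<open>For each \<open>\<xi>\<close>, the curve \<open>t \<mapsto> ex (t \<xi>)\<close> is the one-parameter subgroup with initial
  velocity \<open>\<xi>\<close>. This characterizes \<open>ex\<close> uniquely.\<close>

definition is_exponential_map ::
  "('g, 'm) monoid_scheme \<Rightarrow> 'g topology \<Rightarrow> ('g \<Rightarrow> 'h::real_normed_vector) \<Rightarrow> ('h \<Rightarrow> 'g) \<Rightarrow> bool" where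
  "is_exponential_map H T \<kappa> ex \<longleftrightarrow>
     (\<forall>\<xi>. continuous_map euclideanreal T (\<lambda>t. ex (t *\<^sub>R \<xi>)) \<and>
          (\<forall>t u. ex ((t + u) *\<^sub>R \<xi>) = ex (t *\<^sub>R \<xi>) \<otimes>\<^bsub>H\<^esub> ex (u *\<^sub>R \<xi>)) \<and>
          ((\<lambda>t. \<kappa> (ex (t *\<^sub>R \<xi>))) has_vector_derivative \<xi>) (at 0))"


section \<open>Lifting the derivation action to the group\<close>

text \<open>Differentiating orbits in a possibly infinite-dimensional \<open>'e\<close> requires a topology on it.
  Any Hausdorff locally convex vector topology is allowed: this is the unique Hausdorff vector
  topology if \<open>'e\<close> is finite-dimensional, and every vector space carries one. No continuity is
  asked of the Leibniz product.\<close>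

definition locally_convex_topology :: "'e::real_vector topology \<Rightarrow> bool" where
  "locally_convex_topology T \<longleftrightarrow>
     topspace T = UNIV \<and> Hausdorff_space T \<and>
     continuous_map (prod_topology T T) T (\<lambda>(x, y). x + y) \<and>
     continuous_map (prod_topology euclideanreal T) T (\<lambda>(c, x). c *\<^sub>R x) \<and>
     (\<forall>W. openin T W \<and> 0 \<in> W \<longrightarrow> (\<exists>V. openin T V \<and> convex V \<and> 0 \<in> V \<and> V \<subseteq> W))"

definition lifts_to_group_action ::
  "('e::real_vector \<Rightarrow> 'e \<Rightarrow> 'e) \<Rightarrow> ('h::real_vector \<Rightarrow> 'e \<Rightarrow> 'e) \<Rightarrow> 'e topology \<Rightarrow>
     ('g, 'm) monoid_scheme \<Rightarrow> 'g topology \<Rightarrow> ('h \<Rightarrow> 'g) \<Rightarrow> ('g \<Rightarrow> 'e \<Rightarrow> 'e) \<Rightarrow> bool" where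
  "lifts_to_group_action mul \<rho> TE H T ex \<Phi> \<longleftrightarrow>
     group_action H UNIV \<Phi> \<and>
     (\<forall>a\<in>carrier H. is_automorphism mul (\<Phi> a)) \<and>
     continuous_map (prod_topology T TE) TE (\<lambda>(a, x). \<Phi> a x) \<and>
     (\<forall>\<xi> x. limitin TE (\<lambda>t::real. (\<Phi> (ex (t *\<^sub>R \<xi>)) x - x) /\<^sub>R t) (\<rho> \<xi> x) (at 0))"


section \<open>The product\<close>

text \<open>\<open>exp_s_lambda ex \<Phi> f s x\<close> is \<open>exp (s \<lambda>(x))\<close>.\<close>

definition exp_s_lambda ::
  "('h::real_vector \<Rightarrow> 'g) \<Rightarrow> ('g \<Rightarrow> 'e::real_vector \<Rightarrow> 'e) \<Rightarrow> ('e \<Rightarrow> 'h) \<Rightarrow> real \<Rightarrow> 'e \<Rightarrow> 'e \<Rightarrow> 'e" where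
  "exp_s_lambda ex \<Phi> f s x = \<Phi> (ex (s *\<^sub>R f x))"

definition diamond ::
  "('h::real_vector \<Rightarrow> 'g) \<Rightarrow> ('g \<Rightarrow> 'e::real_vector \<Rightarrow> 'e) \<Rightarrow> ('e \<Rightarrow> 'h) \<Rightarrow> real \<Rightarrow> 'e \<Rightarrow> 'e \<Rightarrow> 'e" where
  "diamond ex \<Phi> f s x y = x + exp_s_lambda ex \<Phi> f s x y"


section \<open>Left loops\<close>

definition left_loop :: "'a set \<Rightarrow> ('a \<Rightarrow> 'a \<Rightarrow> 'a) \<Rightarrow> 'a \<Rightarrow> bool" where
  "left_loop X opr e \<longleftrightarrow>
     (\<forall>a\<in>X. \<forall>b\<in>X. opr a b \<in> X) \<and> e \<in> X \<and>
     (\<forall>a\<in>X. \<forall>b\<in>X. \<exists>!x. x \<in> X \<and> opr a x = b) \<and>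
     (\<forall>a\<in>X. opr e a = a \<and> opr a e = a)"

definition left_inner :: "'a set \<Rightarrow> ('a \<Rightarrow> 'a \<Rightarrow> 'a) \<Rightarrow> 'a \<Rightarrow> 'a \<Rightarrow> 'a \<Rightarrow> 'a" where
  "left_inner X opr a b c = (THE d. d \<in> X \<and> opr a (opr b c) = opr (opr a b) d)"

definition left_inverse_property :: "'a set \<Rightarrow> ('a \<Rightarrow> 'a \<Rightarrow> 'a) \<Rightarrow> bool" where
  "left_inverse_property X opr \<longleftrightarrow>
     (\<forall>a\<in>X. \<exists>a'\<in>X. \<forall>b\<in>X. opr a' (opr a b) = b \<and> opr a (opr a' b) = b)"

definition A_l_property :: "'a set \<Rightarrow> ('a \<Rightarrow> 'a \<Rightarrow> 'a) \<Rightarrow> bool" where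
  "A_l_property X opr \<longleftrightarrow>
     (\<forall>a\<in>X. \<forall>b\<in>X. bij_betw (left_inner X opr a b) X X \<and>
        (\<forall>c\<in>X. \<forall>d\<in>X. left_inner X opr a b (opr c d) =
           opr (left_inner X opr a b c) (left_inner X opr a b d)))"

definition homogeneous_left_loop :: "'a set \<Rightarrow> ('a \<Rightarrow> 'a \<Rightarrow> 'a) \<Rightarrow> 'a \<Rightarrow> bool" where
  "homogeneous_left_loop X opr e \<longleftrightarrow>
     left_loop X opr e \<and> left_inverse_property X opr \<and> A_l_property X opr"


section \<open>The associated Lie-Yamaguti algebra\<close>

text \<open>The \<open>A\<close>-component of \<open>w\<close> in a direct sum \<open>A \<oplus> B\<close>.\<close>

definition component :: "'v::real_vector set \<Rightarrow> 'v set \<Rightarrow> 'v \<Rightarrow> 'v" where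
  "component A B w = (THE a. a \<in> A \<and> (\<exists>b\<in>B. w = a + b))"

text \<open>The binary bracket and the ternary product induced on \<open>M\<close> by a reductive decomposition
  \<open>K \<oplus> M\<close>.\<close>

definition reductive_LY ::
  "('v::real_vector \<Rightarrow> 'v \<Rightarrow> 'v) \<Rightarrow> 'v set \<Rightarrow> 'v set \<Rightarrow> ('v \<Rightarrow> 'v \<Rightarrow> 'v) \<times> ('v \<Rightarrow> 'v \<Rightarrow> 'v \<Rightarrow> 'v)" where
  "reductive_LY brk K M =
     (\<lambda>u v. component M K (brk u v), \<lambda>u v w. brk (component K M (brk u v)) w)"

definition sigma_map :: "('e::real_vector \<Rightarrow> 'h::real_vector) \<Rightarrow> real \<Rightarrow> 'e \<Rightarrow> 'h \<times> 'e" where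
  "sigma_map f s x = (s *\<^sub>R f x, x)"

definition associated_LY ::
  "('h::real_vector \<Rightarrow> 'h \<Rightarrow> 'h) \<Rightarrow> ('h \<Rightarrow> 'e::real_vector \<Rightarrow> 'e) \<Rightarrow> ('e \<Rightarrow> 'h) \<Rightarrow> real \<Rightarrow>
     ('e \<Rightarrow> 'e \<Rightarrow> 'e) \<times> ('e \<Rightarrow> 'e \<Rightarrow> 'e \<Rightarrow> 'e)" where
  "associated_LY br \<rho> f s =
     (let \<sigma> = sigma_map f s;
          (b, t) = reductive_LY (semidirect_bracket br \<rho>) (UNIV \<times> {0}) (range \<sigma>)
      in (\<lambda>x y. inv_into UNIV \<sigma> (b (\<sigma> x) (\<sigma> y)),
          \<lambda>x y z. inv_into UNIV \<sigma> (t (\<sigma> x) (\<sigma> y) (\<sigma> z))))"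

definition LY_bracket ::
  "('h::real_vector \<Rightarrow> 'h \<Rightarrow> 'h) \<Rightarrow> ('h \<Rightarrow> 'e::real_vector \<Rightarrow> 'e) \<Rightarrow> ('e \<Rightarrow> 'h) \<Rightarrow> real \<Rightarrow> 'e \<Rightarrow> 'e \<Rightarrow> 'e" where
  "LY_bracket br \<rho> f s = fst (associated_LY br \<rho> f s)"

end

theory Submission
  imports Defs
begin

text \<open>Write \<open>E x\<close> for \<open>exp (s \<lambda>(x))\<close>. Everything about the loop rests on one identity,
  \<open>F \<circ> E x \<circ> F\<inverse> = E (F x)\<close>, for every \<open>F\<close> by which an element of the group acts. Both sides are
  time-\<open>s\<close> values of one-parameter groups of linear maps, and both groups have the generator
  \<open>\<lambda>(F x)\<close>: the left one because \<open>F\<close> is an automorphism of the Leibniz product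
  (lemma \<open>conjugate_exp_s_lambda\<close>). A one-parameter group \<open>A\<close> acting continuously on a locally
  convex space is determined by its generator, since for another such group \<open>B\<close> the curve
  \<open>t \<mapsto> A (- t) (B t x)\<close> has derivative zero (lemma \<open>one_parameter_group_unique\<close>). As the
  generator may be discontinuous and the space incomplete, an exponential series cannot be used;
  that a curve with zero derivative is constant follows from a mean value argument with convex
  neighbourhoods (lemma \<open>lcs_zero_derivative_imp_constant\<close>).

  In particular \<open>E a (E x y) = E (E a x) (E a y)\<close>, so \<open>E\<close> is a rack structure by linear maps
  with \<open>E (- x)\<close> inverse to \<open>E x\<close>. The left inverse of \<open>a\<close> in the loop \<open>x + E x y\<close> is then
  \<open>- E (- a) a\<close>, and the left inner mapping of \<open>a, b\<close> is the linear map
  \<open>(E (a + E a b))\<inverse> \<circ> E a \<circ> E b\<close>; it commutes with \<open>E\<close> because each factor does, and so it is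
  an automorphism of the loop (lemma \<open>homogeneous_left_loop_of_linear_rack\<close>).

  The bracket is a direct computation: \<open>[\<sigma> x, \<sigma> y]\<close> has \<open>\<E>\<close>-coordinate
  \<open>s (x \<cdot> y - y \<cdot> x)\<close>, and its component in \<open>\<sigma> \<E>\<close> is the image under \<open>\<sigma>\<close> of this
  coordinate, as the complement \<open>\<hh> \<oplus> 0\<close> has no \<open>\<E>\<close>-part.\<close>

section \<open>Loops from linear racks\<close>

text \<open>The linear bijections compatible with \<open>E\<close> are closed under composition and inverses, which
  is how the left inner mappings inherit compatibility from the maps \<open>E a\<close>.\<close>

lemma homogeneous_left_loop_of_linear_rack:
  fixes E :: "'e::real_vector \<Rightarrow> 'e \<Rightarrow> 'e"
  assumes lin: "\<And>a. linear (E a)"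
    and zero: "\<And>y. E 0 y = y"
    and neg: "\<And>a y. E (- a) (E a y) = y"
    and dist: "\<And>a x y. E a (E x y) = E (E a x) (E a y)"
  shows "homogeneous_left_loop UNIV (\<lambda>x y. x + E x y) 0"
proof -
  have neg': "E a (E (- a) y) = y" for a y
    using neg[of "- a" y] by simp
  note add = linear_add[OF lin] and diff = linear_diff[OF lin] and minus = linear_neg[OF lin] and z = linear_0[OF lin]
  have solve: "(a + E a x = b) = (x = E (- a) (b - a))" for a b x
    by (metis add_diff_cancel_left' diff_add_cancel add.commute neg neg')
  have loop: "left_loop UNIV (\<lambda>x y. x + E x y) 0"
    unfolding left_loop_def by (simp add: solve) (simp add: zero z diff neg')
  have inv: "left_inverse_property UNIV (\<lambda>x y. x + E x y)"
    unfolding left_inverse_property_def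
  proof (intro ballI)
    fix a
    let ?a' = "- E (- a) a"
    \<comment> \<open>\<open>E ?a'\<close> is conjugate by \<open>E (- a)\<close> to \<open>E (- a)\<close>, hence equal to it.\<close>
    have Ea': "E ?a' y = E (- a) y" for y
      using dist[of "- a" "- a" "E a y"] by (simp add: neg minus)
    show "\<exists>a'\<in>UNIV. \<forall>b\<in>UNIV. a' + E a' (a + E a b) = b \<and> a + E a (a' + E a' b) = b"
      by (intro bexI[of _ ?a']) (simp_all add: Ea' add diff minus neg neg')
  qed
  have Al: "A_l_property UNIV (\<lambda>x y. x + E x y)"
    unfolding A_l_property_def
  proof (intro ballI)
    fix a b
    define m where "m = a + E a b"
    define L where "L = (\<lambda>c. E (- m) (E a (E b c)))"
    have L: "left_inner UNIV (\<lambda>x y. x + E x y) a b = L"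
    proof
      fix c
      have "(a + E a (b + E b c) = m + E m d) = (d = L c)" for d
      proof -
        have "a + E a (b + E b c) = m + E a (E b c)"
          by (simp add: add m_def add.assoc)
        then show ?thesis
          unfolding L_def by (metis add_left_cancel neg neg')
      qed
      then show "left_inner UNIV (\<lambda>x y. x + E x y) a b c = L c"
        unfolding left_inner_def by (simp flip: m_def)
    qed
    have "bij L"
      by (rule o_bij[where g = "\<lambda>d. E (- b) (E (- a) (E m d))"])
        (simp_all add: fun_eq_iff L_def neg neg')
    moreover have "L (c + E c d) = L c + E (L c) (L d)" for c d
    proof -
      have "L (c + E c d) = L c + L (E c d)"
        by (simp add: L_def add)
      also have "L (E c d) = E (L c) (L d)"
        by (simp only: L_def dist[of b c] dist[of a "E b c"] dist[of "- m" "E a (E b c)"])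
      finally show ?thesis .
    qed
    ultimately show "bij_betw (left_inner UNIV (\<lambda>x y. x + E x y) a b) UNIV UNIV \<and>
        (\<forall>c\<in>UNIV. \<forall>d\<in>UNIV. left_inner UNIV (\<lambda>x y. x + E x y) a b (c + E c d) =
           left_inner UNIV (\<lambda>x y. x + E x y) a b c +
           E (left_inner UNIV (\<lambda>x y. x + E x y) a b c) (left_inner UNIV (\<lambda>x y. x + E x y) a b d))"
      unfolding L by simp
  qed
  show ?thesis
    using loop inv Al by (simp add: homogeneous_left_loop_def)
qed


section \<open>One-parameter groups on locally convex spaces\<close>

lemma limitin_add_lcs:
  assumes "locally_convex_topology T" and "limitin T u l F" and "limitin T v m F"
  shows "limitin T (\<lambda>t. u t + v t) (l + m) F"
proof -
  have "limitin (prod_topology T T) (\<lambda>t. (u t, v t)) (l, m) F"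
    using assms by (simp add: limitin_pairwise o_def)
  then show ?thesis
    using continuous_map_limit[of "prod_topology T T" T "\<lambda>(x, y). x + y"] assms(1)
    by (fastforce simp: locally_convex_topology_def o_def)
qed

lemma limitin_scaleR_lcs:
  assumes "locally_convex_topology T" and "limitin T u l F"
  shows "limitin T (\<lambda>t. c *\<^sub>R u t) (c *\<^sub>R l) F"
proof -
  have "limitin (prod_topology euclideanreal T) (\<lambda>t. (c, u t)) (c, l) F"
    using assms by (simp add: limitin_pairwise o_def)
  then show ?thesis
    using continuous_map_limit[of "prod_topology euclideanreal T" T "\<lambda>(c, x). c *\<^sub>R x"] assms(1)
    by (fastforce simp: locally_convex_topology_def o_def)
qed

lemma limitin_at_0_minus:
  fixes u :: "real \<Rightarrow> 'e"
  assumes "limitin T u l (at 0)"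
  shows "limitin T (\<lambda>h. u (- h)) l (at 0)"
proof -
  have "filterlim uminus (at (0::real)) (at 0)"
    by (rule filterlim_atI) (auto intro!: tendsto_eq_intros simp: eventually_at_filter)
  then show ?thesis
    using assms unfolding limitin_def filterlim_iff by blast
qed

text \<open>Mean value theorem: for a convex neighbourhood \<open>V\<close> of \<open>0\<close>, the increments over
  short intervals around a point lie in \<open>(b - a) V\<close>, a relation that convexity makes stable under
  concatenation of intervals. So it holds over every interval, and if the mean slope \<open>w\<close> of \<open>c\<close>
  were nonzero, a neighbourhood \<open>V\<close> that misses \<open>w\<close> would contradict it.\<close>

lemma lcs_zero_derivative_imp_constant:
  fixes c :: "real \<Rightarrow> 'e::real_vector"
  assumes T: "locally_convex_topology T"
    and deriv: "\<And>t. limitin T (\<lambda>h. (c (t + h) - c t) /\<^sub>R h) 0 (at 0)"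
    and "a \<le> b"
  shows "c a = c b"
proof (rule ccontr)
  assume ne: "c a \<noteq> c b"
  then have "a < b" using \<open>a \<le> b\<close> by (cases "a = b") auto
  define w where "w = (c b - c a) /\<^sub>R (b - a)"
  have "w \<noteq> 0" using ne \<open>a < b\<close> by (simp add: w_def)
  moreover have "0 \<in> topspace T" "w \<in> topspace T" "Hausdorff_space T"
    using T by (auto simp: locally_convex_topology_def)
  ultimately obtain W where W: "openin T W" "0 \<in> W" "w \<notin> W"
    unfolding Hausdorff_space_def disjnt_def by (metis disjoint_iff)
  then obtain V where V: "openin T V" "convex V" "0 \<in> V" "w \<notin> V"
    using T unfolding locally_convex_topology_def by blast
  define P where "P = (\<lambda>(p, q). \<exists>v\<in>V. c q - c p = (q - p) *\<^sub>R v)"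
  have trans: "P (p, r)" if pq: "P (p, q)" and qr: "P (q, r)" and le: "p \<le> q" "q \<le> r" for p q r
  proof -
    obtain v v' where v: "v \<in> V" "c q - c p = (q - p) *\<^sub>R v" "v' \<in> V" "c r - c q = (r - q) *\<^sub>R v'"
      using pq qr by (auto simp: P_def)
    show ?thesis
    proof (cases "p = r")
      case True
      then show ?thesis using V by (auto simp: P_def)
    next
      case False
      then have pr: "0 < r - p" using le by simp
      let ?u = "((q - p) / (r - p)) *\<^sub>R v + ((r - q) / (r - p)) *\<^sub>R v'"
      have "?u \<in> V"
        using v pr le by (intro convexD[OF V(2)]) (auto simp flip: add_divide_distrib)
      moreover have "c r - c p = (r - p) *\<^sub>R ?u"
      proof -
        have "c r - c p = (q - p) *\<^sub>R v + (r - q) *\<^sub>R v'"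
          by (simp flip: v(2,4))
        then show ?thesis using pr by (simp add: scaleR_add_right)
      qed
      ultimately show ?thesis by (auto simp: P_def)
    qed
  qed
  have local: "\<exists>d>0. \<forall>p q. p \<le> x \<and> x \<le> q \<and> q - p < d \<longrightarrow> P (p, q)" for x
  proof -
    have "eventually (\<lambda>h. (c (x + h) - c x) /\<^sub>R h \<in> V) (at 0)"
      using deriv[of x] V by (auto simp: limitin_def)
    then obtain d where d: "d > 0"
      "\<And>h. h \<noteq> 0 \<Longrightarrow> \<bar>h\<bar> < d \<Longrightarrow> (c (x + h) - c x) /\<^sub>R h \<in> V"
      by (auto simp: eventually_at dist_real_def)
    have incr: "\<exists>v\<in>V. c (x + h) - c x = h *\<^sub>R v" if "\<bar>h\<bar> < d" for h
      using d(2)[of h] that V(3)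
      by (cases "h = 0") (auto intro!: bexI[of _ "(c (x + h) - c x) /\<^sub>R h"])
    have "P (p, q)" if pq: "p \<le> x" "x \<le> q" "q - p < d" for p q
    proof (rule trans)
      show "P (x, q)"
        using incr[of "q - x"] pq by (simp add: P_def)
      obtain v where v: "v \<in> V" "c p - c x = (p - x) *\<^sub>R v"
        using incr[of "p - x"] pq by auto
      then have "c x - c p = (x - p) *\<^sub>R v"
        by (metis minus_diff_eq scaleR_minus_left)
      then show "P (p, x)"
        using v by (auto simp: P_def)
    qed (use pq in auto)
    then show ?thesis using d(1) by blast
  qed
  have "P (a, b)"
    by (rule Bolzano[OF \<open>a \<le> b\<close>]) (use trans local in blast)+
  then obtain v where "v \<in> V" "c b - c a = (b - a) *\<^sub>R v"
    by (auto simp: P_def)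
  then have "w \<in> V" using \<open>a < b\<close> by (simp add: w_def)
  then show False using V by simp
qed

text \<open>The product rule for \<open>A (- t) (B t x)\<close> splits its difference quotient into a difference
  quotient of \<open>B\<close> transported by \<open>A (- t - h)\<close> and one of \<open>A\<close> at the fixed vector \<open>B t x\<close>. In the
  first part both the map and the vector move with \<open>h\<close>, which is where joint continuity enters.\<close>

lemma one_parameter_group_unique:
  fixes A B :: "real \<Rightarrow> 'e::real_vector \<Rightarrow> 'e"
  assumes T: "locally_convex_topology T"
    and lin: "\<And>t. linear (A t)"
    and A0: "\<And>x. A 0 x = x" and A_add: "\<And>t u x. A (t + u) x = A t (A u x)"
    and A_cont: "continuous_map (prod_topology euclideanreal T) T (\<lambda>(t, x). A t x)"
    and A_gen: "\<And>x. limitin T (\<lambda>t. (A t x - x) /\<^sub>R t) (D x) (at 0)"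
    and B0: "\<And>x. B 0 x = x" and B_add: "\<And>t u x. B (t + u) x = B t (B u x)"
    and B_gen: "\<And>x. limitin T (\<lambda>t. (B t x - x) /\<^sub>R t) (D x) (at 0)"
    and "0 \<le> t"
  shows "A t x = B t x"
proof -
  have A_lim: "limitin T (\<lambda>h. A (\<tau> h) (y h)) (A \<tau>\<^sub>0 y\<^sub>0) (at 0)"
    if "(\<tau> \<longlongrightarrow> \<tau>\<^sub>0) (at 0)" "limitin T y y\<^sub>0 (at 0)" for \<tau> :: "real \<Rightarrow> real" and \<tau>\<^sub>0 y y\<^sub>0
  proof -
    have "limitin (prod_topology euclideanreal T) (\<lambda>h. (\<tau> h, y h)) (\<tau>\<^sub>0, y\<^sub>0) (at (0::real))"
      using that by (simp add: limitin_pairwise o_def)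
    from continuous_map_limit[OF A_cont this] show ?thesis
      by (simp add: o_def)
  qed
  define c where "c = (\<lambda>t. A (- t) (B t x))"
  have "limitin T (\<lambda>h. (c (t + h) - c t) /\<^sub>R h) 0 (at 0)" for t
  proof -
    let ?y = "B t x"
    have 1: "limitin T (\<lambda>h. A (- t - h) ((B h ?y - ?y) /\<^sub>R h)) (A (- t) (D ?y)) (at 0)"
      by (rule A_lim[OF _ B_gen]) (auto intro!: tendsto_eq_intros)
    have "limitin T (\<lambda>h. (-1) *\<^sub>R ((A (- h) ?y - ?y) /\<^sub>R (- h))) ((-1) *\<^sub>R D ?y) (at 0)"
      by (intro limitin_scaleR_lcs[OF T] limitin_at_0_minus[OF A_gen])
    then have "limitin T (\<lambda>h. (A (- h) ?y - ?y) /\<^sub>R h) (- D ?y) (at 0)"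
      by simp
    then have 2: "limitin T (\<lambda>h. A (- t) ((A (- h) ?y - ?y) /\<^sub>R h)) (A (- t) (- D ?y)) (at 0)"
      by (rule A_lim[OF tendsto_const])
    have "(c (t + h) - c t) /\<^sub>R h =
        A (- t - h) ((B h ?y - ?y) /\<^sub>R h) + A (- t) ((A (- h) ?y - ?y) /\<^sub>R h)" for h
    proof -
      have "B (t + h) x = B h ?y"
        using B_add[of h t] by (simp add: add.commute)
      moreover have "A (- (t + h)) z = A (- t) (A (- h) z)"
        and "A (- t - h) z = A (- t) (A (- h) z)" for z
        using A_add[of "- t" "- h"] by simp_all
      ultimately show ?thesis
        by (simp add: c_def linear_diff[OF lin] linear_scale[OF lin] flip: scaleR_add_right)
    qed
    then show ?thesis
      using limitin_add_lcs[OF T 1 2] by (simp add: linear_neg[OF lin])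
  qed
  then have "c 0 = c t"
    by (rule lcs_zero_derivative_imp_constant[OF T _ \<open>0 \<le> t\<close>])
  then have "x = A (- t) (B t x)"
    by (simp add: c_def A0 B0)
  then have "A t x = A (t + - t) (B t x)"
    by (metis A_add)
  then show ?thesis by (simp add: A0)
qed


section \<open>The exponentials of left multiplications\<close>

lemma group_action_UNIV_mult:
  assumes "group_action H UNIV \<Phi>" "a \<in> carrier H" "b \<in> carrier H"
  shows "\<Phi> (a \<otimes>\<^bsub>H\<^esub> b) x = \<Phi> a (\<Phi> b x)"
  using group_action.composition_rule[OF assms(1) _ assms(2,3)] by simp

lemma group_action_UNIV_one:
  assumes "group_action H UNIV \<Phi>"
  shows "\<Phi> \<one>\<^bsub>H\<^esub> x = x"
  using group_action.id_eq_one[OF assms] by (metis UNIV_I restrict_apply)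

lemma exponential_map_closed:
  assumes "topspace T = carrier H" "is_exponential_map H T \<kappa> ex"
  shows "ex \<xi> \<in> carrier H"
proof -
  have "continuous_map euclideanreal T (\<lambda>t. ex (t *\<^sub>R \<xi>))"
    using assms by (simp add: is_exponential_map_def)
  then have "ex (1 *\<^sub>R \<xi>) \<in> topspace T"
    by (intro continuous_map_image_subset_topspace[THEN subsetD]) (auto intro!: rev_image_eqI[of 1])
  then show ?thesis using assms by simp
qed

lemma exponential_map_add:
  assumes "is_exponential_map H T \<kappa> ex"
  shows "ex ((t + u) *\<^sub>R \<xi>) = ex (t *\<^sub>R \<xi>) \<otimes>\<^bsub>H\<^esub> ex (u *\<^sub>R \<xi>)"
  using assms by (simp add: is_exponential_map_def)

lemma exponential_map_zero:
  assumes "group H" "topspace T = carrier H" "is_exponential_map H T \<kappa> ex"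
  shows "ex 0 = \<one>\<^bsub>H\<^esub>"
  using exponential_map_add[OF assms(3), of 0 0 0] exponential_map_closed[OF assms(2,3), of 0]
    group.r_cancel_one[OF assms(1), of "ex 0" "ex 0"] by simp

locale lifted_derivation_action =
  fixes mul :: "'e::real_vector \<Rightarrow> 'e \<Rightarrow> 'e"
    and br :: "'h::real_normed_vector \<Rightarrow> 'h \<Rightarrow> 'h"
    and \<rho> :: "'h \<Rightarrow> 'e \<Rightarrow> 'e"
    and f :: "'e \<Rightarrow> 'h"
    and H :: "('g, 'm) monoid_scheme"
    and TH :: "'g topology"
    and \<kappa> :: "'g \<Rightarrow> 'h"
    and ex :: "'h \<Rightarrow> 'g"
    and TE :: "'e topology"
    and \<Phi> :: "'g \<Rightarrow> 'e \<Rightarrow> 'e"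
  assumes enveloping: "enveloping_lie_algebra mul br \<rho> f"
    and group: "group H"
    and topspace: "topspace TH = carrier H"
    and exponential: "is_exponential_map H TH \<kappa> ex"
    and lcs: "locally_convex_topology TE"
    and lifts: "lifts_to_group_action mul \<rho> TE H TH ex \<Phi>"
begin

lemma action: "group_action H UNIV \<Phi>"
  using lifts by (simp add: lifts_to_group_action_def)

lemmas ex_closed [simp] = exponential_map_closed[OF topspace exponential]
lemmas \<Phi>_mult = group_action_UNIV_mult[OF action]

lemma automorphism: "a \<in> carrier H \<Longrightarrow> is_automorphism mul (\<Phi> a)"
  using lifts by (simp add: lifts_to_group_action_def)

lemma \<Phi>_linear: "a \<in> carrier H \<Longrightarrow> linear (\<Phi> a)"
  using automorphism by (simp add: is_automorphism_def)

lemma \<Phi>_ex_zero: "\<Phi> (ex 0) x = x"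
  by (simp add: exponential_map_zero[OF group topspace exponential] group_action_UNIV_one[OF action])

lemma \<Phi>_ex_add: "\<Phi> (ex ((t + u) *\<^sub>R \<xi>)) x = \<Phi> (ex (t *\<^sub>R \<xi>)) (\<Phi> (ex (u *\<^sub>R \<xi>)) x)"
  by (simp add: exponential_map_add[OF exponential] \<Phi>_mult)

lemma generator:
  "limitin TE (\<lambda>t. (\<Phi> (ex (t *\<^sub>R f x)) y - y) /\<^sub>R t) (mul x y) (at 0)"
proof -
  have "\<rho> (f x) y = mul x y"
    using enveloping by (simp add: enveloping_lie_algebra_def)
  then show ?thesis
    using lifts unfolding lifts_to_group_action_def by metis
qed

lemma continuous_one_parameter_action:
  "continuous_map (prod_topology euclideanreal TE) TE (\<lambda>(t, x). \<Phi> (ex (t *\<^sub>R \<xi>)) x)"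
proof -
  have ex: "continuous_map euclideanreal TH (\<lambda>t. ex (t *\<^sub>R \<xi>))"
    using exponential by (simp add: is_exponential_map_def)
  have 1: "continuous_map (prod_topology euclideanreal TE) (prod_topology TH TE)
      (\<lambda>p. (ex (fst p *\<^sub>R \<xi>), snd p))"
    using continuous_map_compose[OF continuous_map_fst ex]
    by (simp add: continuous_map_pairwise o_def continuous_map_snd)
  have 2: "continuous_map (prod_topology TH TE) TE (\<lambda>(a, x). \<Phi> a x)"
    using lifts by (simp add: lifts_to_group_action_def)
  show ?thesis
    using continuous_map_compose[OF 1 2] by (simp add: o_def case_prod_unfold)
qed

lemma continuous_action:
  assumes "a \<in> carrier H"
  shows "continuous_map TE TE (\<Phi> a)"
proof -
  have 1: "continuous_map TE (prod_topology TH TE) (\<lambda>x. (a, x))"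
    using assms by (simp add: continuous_map_pairwise o_def topspace)
  have 2: "continuous_map (prod_topology TH TE) TE (\<lambda>(a, x). \<Phi> a x)"
    using lifts by (simp add: lifts_to_group_action_def)
  show ?thesis
    using continuous_map_compose[OF 1 2] by (simp add: o_def)
qed

text \<open>As \<open>\<Phi> a\<close> is an automorphism, it conjugates left multiplication by \<open>x\<close> into left
  multiplication by \<open>\<Phi> a x\<close>. So both sides, as functions of \<open>t\<close> and \<open>\<Phi> a y\<close>, are one-parameter
  groups generated by left multiplication by \<open>\<Phi> a x\<close>.\<close>

lemma conjugate_one_parameter_group:
  assumes a: "a \<in> carrier H" and "0 \<le> t"
  shows "\<Phi> a (\<Phi> (ex (t *\<^sub>R f x)) y) = \<Phi> (ex (t *\<^sub>R f (\<Phi> a x))) (\<Phi> a y)"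
proof -
  define a' where "a' = inv\<^bsub>H\<^esub> a"
  have a': "a' \<in> carrier H" using a group by (simp add: a'_def group.inv_closed)
  have inv1: "\<Phi> a' (\<Phi> a z) = z" and inv2: "\<Phi> a (\<Phi> a' z) = z" for z
    using \<Phi>_mult[OF a' a, of z] \<Phi>_mult[OF a a', of z] a group
    by (simp_all add: a'_def group.l_inv group.r_inv group_action_UNIV_one[OF action])
  define A where "A = (\<lambda>t. \<Phi> (ex (t *\<^sub>R f (\<Phi> a x))))"
  define B where "B = (\<lambda>t z. \<Phi> a (\<Phi> (ex (t *\<^sub>R f x)) (\<Phi> a' z)))"
  have gen: "limitin TE (\<lambda>t. (B t z - z) /\<^sub>R t) (mul (\<Phi> a x) z) (at 0)" for z
  proof -
    have "limitin TE (\<lambda>t. \<Phi> a ((\<Phi> (ex (t *\<^sub>R f x)) (\<Phi> a' z) - \<Phi> a' z) /\<^sub>R t))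
        (\<Phi> a (mul x (\<Phi> a' z))) (at 0)"
      using continuous_map_limit[OF continuous_action[OF a] generator] by (simp add: o_def)
    moreover have "\<Phi> a (mul x (\<Phi> a' z)) = mul (\<Phi> a x) z"
      using automorphism[OF a] by (simp add: is_automorphism_def inv2)
    ultimately show ?thesis
      by (simp add: B_def linear_scale[OF \<Phi>_linear[OF a]] linear_diff[OF \<Phi>_linear[OF a]] inv2)
  qed
  have "A t (\<Phi> a y) = B t (\<Phi> a y)"
  proof (rule one_parameter_group_unique[OF lcs, where A = A and B = B and D = "mul (\<Phi> a x)"])
    show "continuous_map (prod_topology euclideanreal TE) TE (\<lambda>(t, x). A t x)"
      unfolding A_def by (rule continuous_one_parameter_action)
  qed (simp_all add: A_def generator \<Phi>_linear \<Phi>_ex_zero \<Phi>_ex_add gen \<open>0 \<le> t\<close>,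
      simp_all add: B_def \<Phi>_ex_zero \<Phi>_ex_add inv1 inv2)
  then show ?thesis
    by (simp add: A_def B_def inv1)
qed

text \<open>Negative times reduce to positive ones by replacing \<open>x\<close> with \<open>- x\<close>.\<close>

lemma conjugate_exp_s_lambda:
  assumes a: "a \<in> carrier H"
  shows "\<Phi> a (exp_s_lambda ex \<Phi> f s x y) = exp_s_lambda ex \<Phi> f s (\<Phi> a x) (\<Phi> a y)"
proof (cases "0 \<le> s")
  case True
  then show ?thesis
    using conjugate_one_parameter_group[OF a] by (simp add: exp_s_lambda_def)
next
  case False
  have "linear f"
    using enveloping by (simp add: enveloping_lie_algebra_def)
  then show ?thesis
    using conjugate_one_parameter_group[OF a, of "- s" "- x" y] False
    by (simp add: exp_s_lambda_def linear_neg \<Phi>_linear[OF a])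
qed

lemma homogeneous_left_loop_diamond: "homogeneous_left_loop UNIV (diamond ex \<Phi> f s) 0"
proof -
  have f: "linear f"
    using enveloping by (simp add: enveloping_lie_algebra_def)
  let ?E = "exp_s_lambda ex \<Phi> f s"
  have "homogeneous_left_loop UNIV (\<lambda>x y. x + ?E x y) 0"
  proof (rule homogeneous_left_loop_of_linear_rack)
    show "linear (?E a)" for a
      by (simp add: exp_s_lambda_def \<Phi>_linear)
    show "?E 0 y = y" for y
      by (simp add: exp_s_lambda_def linear_0[OF f] \<Phi>_ex_zero)
    show "?E (- a) (?E a y) = y" for a y
      using \<Phi>_ex_add[of "- s" s "f a" y]
      by (simp add: exp_s_lambda_def linear_neg[OF f] \<Phi>_ex_zero)
    show "?E a (?E x y) = ?E (?E a x) (?E a y)" for a x y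
      using conjugate_exp_s_lambda[of "ex (s *\<^sub>R f a)"] by (simp add: exp_s_lambda_def)
  qed
  then show ?thesis by (simp add: diamond_def[abs_def])
qed

end


section \<open>The binary bracket\<close>

lemma component_sigma_map:
  "component (range (sigma_map f s)) (UNIV \<times> {0}) w = sigma_map f s (snd w)"
  unfolding component_def
proof (rule the_equality)
  show "sigma_map f s (snd w) \<in> range (sigma_map f s) \<and>
      (\<exists>b\<in>UNIV \<times> {0}. w = sigma_map f s (snd w) + b)"
    by (auto simp: sigma_map_def prod_eq_iff intro!: exI[of _ "fst w - s *\<^sub>R f (snd w)"])
qed (auto simp: sigma_map_def)

lemma LY_bracket_eq_skew_product:
  assumes "enveloping_lie_algebra mul br \<rho> f"
  shows "LY_bracket br \<rho> f s x y = (2 * s) *\<^sub>R skew_product mul x y"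
proof -
  have \<rho>: "\<rho> (s *\<^sub>R f u) v = s *\<^sub>R mul u v" for u v
    using assms linear_scale[of "\<lambda>\<xi>. \<rho> \<xi> v"]
    by (auto simp: enveloping_lie_algebra_def derivation_action_def)
  have inj: "inj (sigma_map f s)"
    by (auto simp: inj_def sigma_map_def)
  have "LY_bracket br \<rho> f s x y =
      snd (semidirect_bracket br \<rho> (sigma_map f s x) (sigma_map f s y))"
    by (simp add: LY_bracket_def associated_LY_def reductive_LY_def component_sigma_map
        inv_f_f[OF inj] Let_def)
  also have "\<dots> = (2 * s) *\<^sub>R skew_product mul x y"
    by (simp add: semidirect_bracket_def sigma_map_def \<rho> skew_product_def scaleR_diff_right)
  finally show ?thesis .
qed


section \<open>The homogeneous left loop of a Leibniz algebra\<close>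

theorem proposition6p3:
  fixes mul :: "'e::real_vector \<Rightarrow> 'e \<Rightarrow> 'e"
    and br :: "'h::banach \<Rightarrow> 'h \<Rightarrow> 'h"
    and \<rho> :: "'h \<Rightarrow> 'e \<Rightarrow> 'e"
    and f :: "'e \<Rightarrow> 'h"
    and H :: "('g, 'm) monoid_scheme"
    and TH :: "'g topology"
    and \<A> :: "('g set \<times> ('g \<Rightarrow> 'h)) set"
    and U :: "'g set"
    and \<kappa> :: "'g \<Rightarrow> 'h"
    and ex :: "'h \<Rightarrow> 'g"
    and TE :: "'e topology"
    and \<Phi> :: "'g \<Rightarrow> 'e \<Rightarrow> 'e"
    and s :: real
  assumes "leibniz_algebra mul"
    and "enveloping_lie_algebra mul br \<rho> f"
    and "lie_group H TH \<A>"
    and "is_lie_algebra_of br H \<A> U \<kappa>"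
    and "is_exponential_map H TH \<kappa> ex"
    and "locally_convex_topology TE"
    and "lifts_to_group_action mul \<rho> TE H TH ex \<Phi>"
    and "s \<noteq> 0"
  shows "homogeneous_left_loop UNIV (diamond ex \<Phi> f s) 0 \<and>
    (\<forall>x y. LY_bracket br \<rho> f s x y = (2 * s) *\<^sub>R skew_product mul x y) \<and>
    (\<forall>x y. LY_bracket br \<rho> f (1/2) x y = skew_product mul x y)"
proof -
  interpret lifted_derivation_action mul br \<rho> f H TH \<kappa> ex TE \<Phi>
    using assms by (intro lifted_derivation_action.intro) (auto simp: lie_group_def)
  have "LY_bracket br \<rho> f (1/2) x y = skew_product mul x y" for x y
    using LY_bracket_eq_skew_product[OF enveloping, of "1/2"] by simp
  then show ?thesis
    using homogeneous_left_loop_diamond LY_bracket_eq_skew_product[OF enveloping] by blast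
qed

end
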